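(* Let $\mu_x,\mu_y,\mu_{x+y}$ be compactly supported Borel probability measures on $\mathbb{R}$. Let $\Pi$ be the set of Borel probability measures $\pi$ on $\mathbb{R}^2$ with $$\mathrm{Pr}_x(\pi)=\mu_x,\qquad \mathrm{Pr}_y(\pi)=\mu_y,\qquad \mathrm{Pr}_{x+y}(\pi)=\mu_{x+y}.$$ Assume that $\Pi$ is nonempty and that $\pi\in\Pi$ is an extreme point of $\Pi$. Then there exists a set $S\subset\mathbb{R}^2$ of (two-dimensional) Lebesgue measure zero such that $\pi(S)=1$.
   Context: $\mathrm{Pr}_x(\pi)$, $\mathrm{Pr}_y(\pi)$, $\mathrm{Pr}_{x+y}(\pi)$ denote the push-forwards of $\pi$ under the maps $(x,y)\mapsto x$, $(x,y)\mapsto y$, $(x,y)\mapsto x+y$ from $\mathbb{R}^2$ to $\mathbb{R}$, respectively. An extreme point of the convex set $\Pi$ is an element that is not of the form $\tfrac12(\pi_1+\pi_2)$ with $\pi_1\ne\pi_2$ in $\Pi$. *)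

theory Defs
  imports "HOL-Probability.Probability"
begin

definition borel_prob :: "'a::topological_space measure \<Rightarrow> bool" where
  "borel_prob M \<longleftrightarrow> prob_space M \<and> sets M = sets borel"

definition msupport :: "'a::topological_space measure \<Rightarrow> 'a set" where
  "msupport M = {x. \<forall>U. open U \<and> x \<in> U \<longrightarrow> emeasure M U > 0}"

definition compactly_supported :: "'a::topological_space measure \<Rightarrow> bool" where
  "compactly_supported M \<longleftrightarrow> compact (msupport M)"

definition Pr_x :: "(real \<times> real) measure \<Rightarrow> real measure" where
  "Pr_x \<pi> = distr \<pi> borel (\<lambda>(x, y). x)"

definition Pr_y :: "(real \<times> real) measure \<Rightarrow> real measure" where
  "Pr_y \<pi> = distr \<pi> borel (\<lambda>(x, y). y)"

definition Pr_sum :: "(real \<times> real) measure \<Rightarrow> real measure" where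
  "Pr_sum \<pi> = distr \<pi> borel (\<lambda>(x, y). x + y)"

definition plans :: "real measure \<Rightarrow> real measure \<Rightarrow> real measure \<Rightarrow> (real \<times> real) measure set" where
  "plans \<mu>x \<mu>y \<mu>s = {\<pi>. borel_prob \<pi> \<and> Pr_x \<pi> = \<mu>x \<and> Pr_y \<pi> = \<mu>y \<and> Pr_sum \<pi> = \<mu>s}"

(* Measures do not form a vector space in the library, so the identity M = (M1 + M2)/2 is
   stated setwise. It has this meaning when M, M1 and M2 are finite measures on the same
   sigma-algebra, as is the case for members of plans. *)
definition is_midpoint :: "'a measure \<Rightarrow> 'a measure \<Rightarrow> 'a measure \<Rightarrow> bool" where
  "is_midpoint M M1 M2 \<longleftrightarrow> (\<forall>A\<in>sets M. measure M A = (measure M1 A + measure M2 A) / 2)"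

definition extreme_measure :: "'a measure set \<Rightarrow> 'a measure \<Rightarrow> bool" where
  "extreme_measure P M \<longleftrightarrow>
     M \<in> P \<and> \<not> (\<exists>M1\<in>P. \<exists>M2\<in>P. M1 \<noteq> M2 \<and> is_midpoint M M1 M2)"

end

theory Submission
  imports Defs
begin

text \<open>
  If \<open>\<pi>\<close> is not singular, a Hahn decomposition of \<open>\<pi> - \<epsilon> * lborel\<close> for small \<open>\<epsilon>\<close> yields a bounded
  set \<open>A\<close> of positive area on which \<open>\<pi> \<ge> \<epsilon> * lborel\<close>. As in the proof of Steinhaus' theorem,
  \<open>A\<close> contains six small translates \<open>B + t v\<close> of a set \<open>B\<close> of positive area, where \<open>v\<close> runs
  through the vertices of the hexagon \<open>(1,0), (0,1), (-1,1), (-1,0), (0,-1), (1,-1)\<close>. Every line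
  \<open>x = const\<close>, \<open>y = const\<close> or \<open>x + y = const\<close> through a vertex contains exactly two vertices, and
  their signs are opposite when the signs alternate around the hexagon. Moving mass \<open>\<epsilon> * lborel\<close>
  from the negative to the positive translates, or back, therefore changes no marginal, and
  \<open>\<pi>\<close> is the midpoint of the two resulting plans.
\<close>

section \<open>Sums and differences of finite measures\<close>

definition add_measure :: "'a measure \<Rightarrow> 'a measure \<Rightarrow> 'a measure" where
  "add_measure M N = measure_of (space M) (sets M) (\<lambda>A. emeasure M A + emeasure N A)"

lemma sets_add_measure [simp]: "sets (add_measure M N) = sets M"
  by (simp add: add_measure_def)

lemma emeasure_add_measure:
  assumes "sets N = sets M" "A \<in> sets M"
  shows "emeasure (add_measure M N) A = emeasure M A + emeasure N A"
  unfolding add_measure_def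
proof (rule emeasure_measure_of_sigma)
  show "countably_additive (sets M) (\<lambda>A. emeasure M A + emeasure N A)"
    by (auto intro!: countably_additiveI simp: suminf_add[symmetric] suminf_emeasure assms(1))
qed (auto simp: positive_def assms sets.sigma_algebra_axioms)

text \<open>The domination of \<open>N\<close> by \<open>M\<close> makes
  \<open>diff_measure M N\<close> a measure, to which \<open>P\<close> is then added. The result is
  expressed through \<open>measure\<close> rather than \<open>emeasure\<close> so that the
  subtraction is the one of the reals and terms cancel freely.\<close>

lemma exists_measure_minus_plus:
  assumes "finite_measure M" "finite_measure N" "finite_measure P"
    and sets: "sets N = sets M" "sets P = sets M"
    and le: "\<And>X. X \<in> sets M \<Longrightarrow> emeasure N X \<le> emeasure M X"
  obtains M' where "finite_measure M'" "sets M' = sets M"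
    "\<And>X. X \<in> sets M \<Longrightarrow> measure M' X = measure M X - measure N X + measure P X"
proof -
  interpret M: finite_measure M by fact
  interpret N: finite_measure N by fact
  interpret P: finite_measure P by fact
  define M' where "M' = add_measure (diff_measure M N) P"
  \<comment> \<open>\<open>ennreal\<close> sends negative reals to 0, so passing between
    \<open>emeasure\<close> and \<open>measure\<close> below relies on this difference being
    nonnegative.\<close>
  have le': "measure N X \<le> measure M X" if "X \<in> sets M" for X
    using le[OF that] by (simp add: M.emeasure_eq_measure N.emeasure_eq_measure)
  have em: "emeasure M' X = ennreal (measure M X - measure N X + measure P X)" if "X \<in> sets M" for X
  proof -
    have "emeasure (diff_measure M N) X = emeasure M X - emeasure N X"
      by (rule emeasure_diff_measure) (use assms that in auto)
    also have "\<dots> = ennreal (measure M X - measure N X)"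
      by (simp add: M.emeasure_eq_measure N.emeasure_eq_measure ennreal_minus)
    finally show ?thesis
      using that le'[OF that] unfolding M'_def
      by (simp add: emeasure_add_measure sets P.emeasure_eq_measure flip: ennreal_plus)
  qed
  have s: "sets M' = sets M" by (simp add: M'_def)
  show thesis
  proof
    show "finite_measure M'"
      using em[OF sets.top] sets_eq_imp_space_eq[OF s] by (intro finite_measureI) auto
    show "measure M' X = measure M X - measure N X + measure P X" if "X \<in> sets M" for X
      using em[OF that] le'[OF that] by (simp add: measure_def del: ennreal_plus)
  qed fact
qed

section \<open>Perturbing a plan without changing its marginals\<close>

lemma borel_Pr_maps [measurable]:
  "(\<lambda>(x, y). x) \<in> borel_measurable (borel :: (real \<times> real) measure)"
  "(\<lambda>(x, y). y) \<in> borel_measurable (borel :: (real \<times> real) measure)"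
  "(\<lambda>(x, y). x + y) \<in> borel_measurable (borel :: (real \<times> real) measure)"
  unfolding case_prod_beta borel_prod[symmetric] by measurable

lemma shifted_plan:
  fixes \<pi> N P :: "(real \<times> real) measure"
  assumes \<pi>: "\<pi> \<in> plans \<mu>x \<mu>y \<mu>s"
    and fin: "finite_measure N" "finite_measure P"
    and sets: "sets N = sets borel" "sets P = sets borel"
    and le: "\<And>X. X \<in> sets borel \<Longrightarrow> emeasure N X \<le> emeasure \<pi> X"
    and eq: "Pr_x N = Pr_x P" "Pr_y N = Pr_y P" "Pr_sum N = Pr_sum P"
  obtains \<pi>' where "\<pi>' \<in> plans \<mu>x \<mu>y \<mu>s"
    "\<And>X. X \<in> sets borel \<Longrightarrow> measure \<pi>' X = measure \<pi> X - measure N X + measure P X"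
proof -
  from \<pi> have prob: "prob_space \<pi>" and s: "sets \<pi> = sets borel"
    by (auto simp: plans_def borel_prob_def)
  interpret \<pi>: prob_space \<pi> by fact
  obtain \<pi>' where fin': "finite_measure \<pi>'" and s': "sets \<pi>' = sets \<pi>"
    and m: "\<And>X. X \<in> sets \<pi> \<Longrightarrow> measure \<pi>' X = measure \<pi> X - measure N X + measure P X"
    using exists_measure_minus_plus[OF \<pi>.finite_measure_axioms fin] sets s le by metis
  interpret \<pi>': finite_measure \<pi>' by fact
  have distr_eq: "distr \<pi>' borel f = distr \<pi> borel f"
    if f: "f \<in> borel_measurable borel" and eq: "distr N borel f = distr P borel f"
    for f :: "real \<times> real \<Rightarrow> real"
  proof (rule measure_eqI)
    fix E assume "E \<in> sets (distr \<pi>' borel f)"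
    then have E: "E \<in> sets borel" by simp
    have X: "f -` E \<in> sets borel"
      using measurable_sets[OF f E] by simp
    have [measurable_cong]: "sets \<pi> = sets borel" "sets \<pi>' = sets borel"
      "sets N = sets borel" "sets P = sets borel" using s s' sets by simp_all
    have sp: "space \<pi> = UNIV" "space \<pi>' = UNIV" "space N = UNIV" "space P = UNIV"
      using s s' sets by (metis sets_eq_imp_space_eq space_borel)+
    have "measure N (f -` E) = measure P (f -` E)"
      using arg_cong[OF eq, of "\<lambda>M. measure M E"] f E by (simp add: measure_distr sp)
    then have "measure \<pi>' (f -` E) = measure \<pi> (f -` E)"
      using m X s by simp
    then show "emeasure (distr \<pi>' borel f) E = emeasure (distr \<pi> borel f) E"
      using f E by (simp add: emeasure_distr sp \<pi>.emeasure_eq_measure \<pi>'.emeasure_eq_measure)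
  qed simp
  have Pr: "Pr_x \<pi>' = Pr_x \<pi>" "Pr_y \<pi>' = Pr_y \<pi>" "Pr_sum \<pi>' = Pr_sum \<pi>"
    using eq unfolding Pr_x_def Pr_y_def Pr_sum_def by (auto intro!: distr_eq)
  \<comment> \<open>A push-forward keeps the total mass, so the mass of \<pi>' can be read off its
    first marginal, which is that of \<pi>.\<close>
  have "emeasure \<pi>' (space \<pi>') = 1"
  proof -
    have f: "(\<lambda>(x, y). x) \<in> borel_measurable \<pi>" "(\<lambda>(x, y). x) \<in> borel_measurable \<pi>'"
      by (simp_all add: s s' cong: measurable_cong_sets)
    have "emeasure (Pr_x \<pi>') UNIV = emeasure \<pi>' (space \<pi>')"
      "emeasure (Pr_x \<pi>) UNIV = emeasure \<pi> (space \<pi>)"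
      unfolding Pr_x_def using f by (simp_all add: emeasure_distr)
    then show ?thesis using Pr \<pi>.emeasure_space_1 by simp
  qed
  then have "\<pi>' \<in> plans \<mu>x \<mu>y \<mu>s"
    using \<pi> Pr s s' by (auto simp: plans_def borel_prob_def intro!: prob_spaceI)
  then show thesis using that m s by simp
qed

text \<open>Both \<pi> - N + P and \<pi> - P + N are plans, and \<pi> is their midpoint. On
  \<open>X\<close> they differ by twice the difference of \<open>P\<close> and \<open>N\<close>, so
  extremality forces that difference to vanish.\<close>

lemma extreme_plan_rigid:
  fixes \<pi> N P :: "(real \<times> real) measure"
  assumes ext: "extreme_measure (plans \<mu>x \<mu>y \<mu>s) \<pi>"
    and fin: "finite_measure N" "finite_measure P"
    and sets: "sets N = sets borel" "sets P = sets borel"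
    and le: "\<And>X. X \<in> sets borel \<Longrightarrow> emeasure N X \<le> emeasure \<pi> X"
      "\<And>X. X \<in> sets borel \<Longrightarrow> emeasure P X \<le> emeasure \<pi> X"
    and eq: "Pr_x N = Pr_x P" "Pr_y N = Pr_y P" "Pr_sum N = Pr_sum P"
    and X: "X \<in> sets borel"
  shows "measure N X = measure P X"
proof (rule ccontr)
  assume neq: "measure N X \<noteq> measure P X"
  from ext have \<pi>: "\<pi> \<in> plans \<mu>x \<mu>y \<mu>s" by (simp add: extreme_measure_def)
  then have s: "sets \<pi> = sets borel" by (simp add: plans_def borel_prob_def)
  obtain \<pi>1 where 1: "\<pi>1 \<in> plans \<mu>x \<mu>y \<mu>s"
    "\<And>X. X \<in> sets borel \<Longrightarrow> measure \<pi>1 X = measure \<pi> X - measure N X + measure P X"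
    using shifted_plan[OF \<pi> fin sets le(1) eq] by metis
  obtain \<pi>2 where 2: "\<pi>2 \<in> plans \<mu>x \<mu>y \<mu>s"
    "\<And>X. X \<in> sets borel \<Longrightarrow> measure \<pi>2 X = measure \<pi> X - measure P X + measure N X"
    using shifted_plan[OF \<pi> fin(2,1) sets(2,1) le(2) eq[symmetric]] by metis
  have "\<pi>1 \<noteq> \<pi>2" using 1(2)[OF X] 2(2)[OF X] neq by auto
  moreover have "is_midpoint \<pi> \<pi>1 \<pi>2" using 1 2 s by (simp add: is_midpoint_def)
  ultimately show False using ext 1 2 by (auto simp: extreme_measure_def)
qed

section \<open>Singularity, or domination of a multiple of Lebesgue measure\<close>

text \<open>On the ball of radius \<open>n\<close>, \<open>M\<close> is compared with
  \<open>c n\<close> times Lebesgue measure by a Hahn decomposition with positive part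
  \<open>Y n\<close>. If some \<open>Y n\<close> has positive Lebesgue measure, it serves as
  \<open>A\<close>. Otherwise the union of all \<open>Y n\<close> is a null set, and it carries
  \<open>M\<close> because \<open>c n\<close> tends to 0.\<close>

lemma null_or_dominates_lborel:
  fixes M :: "'a::euclidean_space measure"
  assumes "finite_measure M" and s: "sets M = sets borel"
  shows "(\<exists>S\<in>null_sets lborel. emeasure M S = emeasure M UNIV) \<or>
    (\<exists>A\<in>sets borel. \<exists>\<epsilon>>0. bounded A \<and> emeasure lborel A > 0 \<and>
      (\<forall>X\<in>sets borel. X \<subseteq> A \<longrightarrow> ennreal \<epsilon> * emeasure lborel X \<le> emeasure M X))"
proof -
  interpret finite_measure M by fact
  have sp: "space M = UNIV" using sets_eq_imp_space_eq[OF s] by simp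
  \<comment> \<open>The \<open>Suc\<close> keeps \<open>c n\<close> positive at \<open>n = 0\<close>
    as well, since \<open>c n\<close> is the \<epsilon> of the second alternative.\<close>
  define c where "c n = 1 / real (Suc n)" for n
  \<comment> \<open>The Hahn decomposition is taken between measures finite on the given set, hence
    the restriction to balls.\<close>
  have fin: "emeasure lborel (cball (0::'a) r) \<noteq> \<infinity>" for r
    using emeasure_compact_finite[of "cball (0::'a) r"] by simp
  have "\<exists>Y\<in>sets M. Y \<subseteq> cball 0 (real n) \<and>
      (\<forall>X\<in>sets M. X \<subseteq> Y \<longrightarrow> scale_measure (ennreal (c n)) lborel X \<le> M X) \<and>
      (\<forall>X\<in>sets M. X \<subseteq> cball 0 (real n) \<longrightarrow> X \<inter> Y = {} \<longrightarrow>
        M X \<le> scale_measure (ennreal (c n)) lborel X)" for n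
    using fin by (intro unsigned_Hahn_decomposition)
      (auto simp: s ennreal_mult_eq_top_iff)
  then obtain Y where Y: "\<And>n. Y n \<in> sets borel" "\<And>n. Y n \<subseteq> cball 0 (real n)"
    and Y1: "\<And>n X. X \<in> sets borel \<Longrightarrow> X \<subseteq> Y n \<Longrightarrow> ennreal (c n) * emeasure lborel X \<le> emeasure M X"
    and Y2: "\<And>n X. X \<in> sets borel \<Longrightarrow> X \<subseteq> cball 0 (real n) \<Longrightarrow> X \<inter> Y n = {} \<Longrightarrow>
        emeasure M X \<le> ennreal (c n) * emeasure lborel X"
    unfolding s by simp metis
  show ?thesis
  proof (cases "\<exists>n. emeasure lborel (Y n) > 0")
    case True
    then obtain n where "emeasure lborel (Y n) > 0" by blast
    moreover have "bounded (Y n)" using Y(2) bounded_cball bounded_subset by blast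
    moreover have "c n > 0" by (simp add: c_def)
    ultimately show ?thesis using Y(1) Y1 by blast
  next
    case False
    define S where "S = (\<Union>n. Y n)"
    have S: "S \<in> null_sets lborel"
      using False Y(1) unfolding S_def by (intro null_sets_UN) (auto simp: null_sets_def)
    then have [measurable]: "S \<in> sets borel" by auto
    have "cball 0 (real m) - S \<in> null_sets M" for m
    proof -
      define X where "X = cball 0 (real m) - S"
      have X: "X \<in> sets borel" by (simp add: X_def)
      define b where "b = measure lborel (cball (0::'a) (real m))"
      \<comment> \<open>For m \<le> n the set \<open>X\<close> lies in the ball of the
        \<open>n\<close>-th decomposition and misses \<open>Y n\<close>. With \<open>m\<close>
        fixed, letting \<open>n\<close> grow yields measure 0.\<close>
      have "measure M X \<le> c n * b" if "m \<le> n" for n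
      proof -
        have "emeasure M X \<le> ennreal (c n) * emeasure lborel X"
          using that by (intro Y2 X) (auto simp: X_def S_def)
        also have "\<dots> \<le> ennreal (c n) * emeasure lborel (cball (0::'a) (real m))"
          by (intro mult_left_mono emeasure_mono) (auto simp: X_def)
        also have "\<dots> = ennreal (c n * b)"
          using fin[of "real m"] by (simp add: b_def emeasure_eq_ennreal_measure ennreal_mult[symmetric] c_def)
        finally show ?thesis
          by (simp add: emeasure_eq_measure b_def c_def)
      qed
      moreover have "(\<lambda>n. c n * b) \<longlonglongrightarrow> 0"
        unfolding c_def using LIMSEQ_Suc[OF lim_1_over_n[where 'a=real]]
        by (intro tendsto_mult_left_zero) simp
      ultimately have "measure M X \<le> 0"
        by (intro LIMSEQ_le_const) auto
      then have "emeasure M X = 0"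
        by (simp add: emeasure_eq_measure measure_le_0_iff)
      then show ?thesis using X s by (simp add: null_sets_def X_def)
    qed
    then have "(\<Union>m. cball 0 (real m) - S) \<in> null_sets M" by (intro null_sets_UN)
    moreover have "(\<Union>m. cball 0 (real m) - S) = UNIV - S"
      using real_arch_simple by (auto simp: mem_cball_0)
    ultimately have "emeasure M (UNIV - S) = 0" by auto
    then have "emeasure M S = emeasure M UNIV"
      using emeasure_Diff_null_set[of "UNIV - S" M UNIV] s by (simp add: null_sets_def Diff_Diff_Int)
    then show ?thesis using S by blast
  qed
qed

section \<open>Common translates inside a set of positive Lebesgue measure\<close>

lemma emeasure_lborel_translate:
  fixes a :: "'a::euclidean_space"
  assumes "X \<in> sets borel"
  shows "{z. a + z \<in> X} \<in> sets borel" "emeasure lborel {z. a + z \<in> X} = emeasure lborel X"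
proof -
  have "(+) a -` X \<inter> space borel \<in> sets borel"
    using assms by (intro measurable_sets[where A=borel]) auto
  then show "{z. a + z \<in> X} \<in> sets borel" by (simp add: vimage_def)
  have "emeasure lborel X = emeasure (distr lborel borel ((+) a)) X"
    by (simp add: lborel_distr_plus)
  also have "\<dots> = emeasure lborel {z. a + z \<in> X}"
    using assms by (subst emeasure_distr) (auto simp: vimage_def)
  finally show "emeasure lborel {z. a + z \<in> X} = emeasure lborel X" by simp
qed

text \<open>Inner regularity is applied to Lebesgue measure restricted to \<open>A\<close>, which is
  finite because \<open>A\<close> is bounded.\<close>

lemma exists_compact_subset_pos:
  fixes A :: "'a::euclidean_space set"
  assumes A: "A \<in> sets borel" "bounded A" "emeasure lborel A > 0"
  obtains K where "compact K" "K \<subseteq> A" "emeasure lborel K > 0"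
proof -
  define M where "M = density lborel (indicator A :: 'a \<Rightarrow> ennreal)"
  have M: "emeasure M X = emeasure lborel (A \<inter> X)" if "X \<in> sets borel" for X
    using that A by (simp add: M_def emeasure_restricted)
  have "emeasure M (space M) \<noteq> \<infinity>"
    using M[of UNIV] A emeasure_bounded_finite[of A] by (simp add: M_def)
  then have "emeasure M A = (SUP K \<in> {K. K \<subseteq> A \<and> compact K}. emeasure M K)"
    using A by (intro inner_regular) (auto simp: M_def)
  then have "0 < (SUP K \<in> {K. K \<subseteq> A \<and> compact K}. emeasure M K)"
    using A M[of A] by simp
  then obtain K where "K \<subseteq> A" "compact K" "0 < emeasure M K"
    unfolding less_SUP_iff by blast
  then show thesis using that M[of K] borel_compact[of K] by (simp add: Int_absorb1)
qed

text \<open>Take a compact \<open>K\<close> in \<open>A\<close> of positive measure and an open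
  \<open>U\<close> around it with \<open>U - K\<close> small. For small \<open>t\<close> every shift
  of \<open>K\<close> by \<open>t v\<close> stays in \<open>U\<close>, so a point of
  \<open>K\<close> outside the intersection is shifted into \<open>U - K\<close> by some
  \<open>t v\<close>. These bad points have total measure less than that of
  \<open>K\<close>.\<close>

lemma common_translates_pos:
  fixes A :: "'a::euclidean_space set"
  assumes A: "A \<in> sets borel" "bounded A" "emeasure lborel A > 0" and V: "finite V"
  obtains t :: real where "t > 0" "emeasure lborel (\<Inter>v\<in>V. {z. t *\<^sub>R v + z \<in> A}) > 0"
proof -
  obtain K where K: "compact K" "K \<subseteq> A" "emeasure lborel K > 0"
    using exists_compact_subset_pos[OF A] .
  have Kb: "K \<in> sets borel" using borel_compact[OF K(1)] .
  have Kfin: "emeasure lborel K \<noteq> \<infinity>" using emeasure_compact_finite[OF K(1)] by simp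
  define k where "k = measure lborel K"
  have k: "emeasure lborel K = ennreal k" "k > 0"
    using Kfin K(3) by (auto simp: k_def emeasure_eq_ennreal_measure)
  \<comment> \<open>There is one bad set of measure at most \<open>d\<close> for each element of
    \<open>V\<close>; the \<open>Suc\<close> makes their sum strictly smaller than \<open>k\<close>
    and covers empty \<open>V\<close>.\<close>
  define d where "d = k / real (Suc (card V))"
  have d: "d > 0" "real (card V) * d < k" using k(2) by (auto simp: d_def field_simps)
  obtain U where U: "open U" "K \<subseteq> U" "emeasure lborel (U - K) < ennreal d"
    using outer_regular_lborel[OF Kb d(1)] .
  obtain e where e: "e > 0" "(\<Union>x\<in>K. cball x e) \<subseteq> U"
    using compact_subset_open_imp_cball_epsilon_subset[OF K(1) U(1,2)] .
  \<comment> \<open>Inserting 1 makes \<open>Max\<close> meaningful for empty \<open>V\<close> and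
    \<open>m\<close> positive, so that \<open>e / m\<close> is a valid scale.\<close>
  define m where "m = Max (insert 1 (norm ` V))"
  have m: "m \<ge> 1" "\<And>v. v \<in> V \<Longrightarrow> norm v \<le> m" using V by (auto simp: m_def)
  define t where "t = e / m"
  have t: "t > 0" "\<And>v. v \<in> V \<Longrightarrow> norm (t *\<^sub>R v) \<le> e"
    using e(1) m by (auto simp: t_def field_simps intro!: mult_left_mono)
  have Ub: "U - K \<in> sets borel" using U(1) Kb by auto
  define G where "G = (\<Inter>v\<in>V. {z. t *\<^sub>R v + z \<in> A})"
  define D where "D v = {z. t *\<^sub>R v + z \<in> U - K}" for v
  have D: "D v \<in> sets borel" "emeasure lborel (D v) \<le> ennreal d" for v
    using emeasure_lborel_translate[OF Ub] U(3) by (auto simp: D_def)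
  have G: "G \<in> sets borel"
    using V emeasure_lborel_translate(1)[OF A(1)] unfolding G_def
    by (cases "V = {}") auto
  have "K \<subseteq> G \<union> (\<Union>v\<in>V. D v)"
  proof
    fix z assume z: "z \<in> K"
    have "t *\<^sub>R v + z \<in> U" if "v \<in> V" for v
    proof -
      have "t *\<^sub>R v + z \<in> cball z e" using t(2)[OF that] by (simp add: dist_norm)
      then show ?thesis using e(2) z by blast
    qed
    then show "z \<in> G \<union> (\<Union>v\<in>V. D v)" using K(2) by (auto simp: G_def D_def)
  qed
  then have "emeasure lborel K \<le> emeasure lborel (G \<union> (\<Union>v\<in>V. D v))"
    using G D V by (intro emeasure_mono) auto
  also have "\<dots> \<le> emeasure lborel G + emeasure lborel (\<Union>v\<in>V. D v)"
    using G D V by (intro emeasure_subadditive) auto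
  also have "emeasure lborel (\<Union>v\<in>V. D v) \<le> (\<Sum>v\<in>V. emeasure lborel (D v))"
    using D V by (intro emeasure_subadditive_finite) auto
  also have "\<dots> \<le> (\<Sum>v\<in>V. ennreal d)" using D by (intro sum_mono)
  also have "\<dots> = ennreal (real (card V) * d)"
    using d by (simp add: ennreal_mult ennreal_of_nat_eq_real_of_nat)
  finally have "ennreal k \<le> emeasure lborel G + ennreal (real (card V) * d)"
    using k by (simp add: add_left_mono)
  \<comment> \<open>If \<open>G\<close> were null, the last inequality would read k \<le> card V *
    d.\<close>
  then have "emeasure lborel G \<noteq> 0" using d k by (auto simp: ennreal_le_iff2)
  then show thesis using that[of t] t(1) by (simp add: G_def zero_less_iff_neq_zero)
qed


section \<open>Grid cells and disjoint translates\<close>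

text \<open>The countably many cells cover \<open>G\<close>, so they cannot all meet it in null
  sets. Confining a set to one cell is what later makes its translates disjoint.\<close>

lemma exists_grid_cell_pos:
  fixes G :: "(real \<times> real) set"
  assumes G: "G \<in> sets borel" "emeasure lborel G > 0"
  obtains m n :: int where
    "{z \<in> G. \<lfloor>fst z / t\<rfloor> = m \<and> \<lfloor>snd z / t\<rfloor> = n} \<in> sets borel"
    "emeasure lborel {z \<in> G. \<lfloor>fst z / t\<rfloor> = m \<and> \<lfloor>snd z / t\<rfloor> = n} > 0"
proof -
  define C where "C = (\<lambda>(m, n). {z \<in> G. \<lfloor>fst z / t\<rfloor> = m \<and> \<lfloor>snd z / t\<rfloor> = n})"
  have C: "C p \<in> sets borel" for p
  proof -
    have [measurable]: "fst \<in> borel_measurable (borel :: (real \<times> real) measure)"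
      "snd \<in> borel_measurable (borel :: (real \<times> real) measure)"
      unfolding borel_prod[symmetric] by measurable
    have "{z \<in> space borel. \<lfloor>fst z / t\<rfloor> = fst p \<and> \<lfloor>snd z / t\<rfloor> = snd p} \<in> sets borel"
      by measurable
    then have "G \<inter> {z \<in> space borel. \<lfloor>fst z / t\<rfloor> = fst p \<and> \<lfloor>snd z / t\<rfloor> = snd p} \<in> sets borel"
      using G by blast
    moreover have "C p = G \<inter> {z \<in> space borel. \<lfloor>fst z / t\<rfloor> = fst p \<and> \<lfloor>snd z / t\<rfloor> = snd p}"
      by (auto simp: C_def case_prod_beta)
    ultimately show ?thesis by simp
  qed
  have "\<exists>p. emeasure lborel (C p) > 0"
  proof (rule ccontr)
    assume "\<not> ?thesis"
    then have "(\<Union>p. C p) \<in> null_sets lborel"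
      using C by (intro null_sets_UN') (auto simp: null_sets_def)
    moreover have "(\<Union>p. C p) = G" by (auto simp: C_def)
    ultimately show False using G by auto
  qed
  then show thesis using that C by (auto simp: C_def)
qed

text \<open>The union of the sets \<open>B + t v\<close>, each written as a preimage of
  \<open>B\<close> under a translation so that \<open>emeasure_lborel_translate\<close>
  applies.\<close>

definition translates :: "real \<Rightarrow> (real \<times> real) set \<Rightarrow> (real \<times> real) set \<Rightarrow> (real \<times> real) set" where
  "translates t V B = (\<Union>v\<in>V. {z. - (t *\<^sub>R v) + z \<in> B})"

lemma translates_borel: "finite V \<Longrightarrow> B \<in> sets borel \<Longrightarrow> translates t V B \<in> sets borel"
  unfolding translates_def by (intro sets.finite_UN emeasure_lborel_translate(1)) auto

text \<open>Translating by \<open>t\<close> times an integer vector shifts the cell indices by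
  exactly that vector, so the cell of \<open>z\<close> together with \<open>(m, n)\<close>
  determines the vector.\<close>

lemma grid_translates_disjoint:
  assumes "t > 0" "v \<in> \<int> \<times> \<int>" "w \<in> \<int> \<times> \<int>"
    and "- (t *\<^sub>R v) + z \<in> B" "- (t *\<^sub>R w) + z \<in> B"
    and B: "B \<subseteq> {z. \<lfloor>fst z / t\<rfloor> = m \<and> \<lfloor>snd z / t\<rfloor> = n}"
  shows "v = w"
proof -
  obtain a b where v: "v = (of_int a, of_int b)" using assms(2) by (auto elim!: Ints_cases)
  obtain c d where w: "w = (of_int c, of_int d)" using assms(3) by (auto elim!: Ints_cases)
  have e: "(x - t * of_int i) / t = x / t - of_int i" for i x
    using \<open>t > 0\<close> by (simp add: field_simps)
  have "\<lfloor>fst z / t\<rfloor> - a = m" "\<lfloor>snd z / t\<rfloor> - b = n" "\<lfloor>fst z / t\<rfloor> - c = m" "\<lfloor>snd z / t\<rfloor> - d = n"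
    using subsetD[OF B assms(4)] subsetD[OF B assms(5)] by (simp_all add: v w e)
  then show ?thesis by (simp add: v w)
qed

lemma emeasure_translates_vimage:
  fixes f :: "real \<times> real \<Rightarrow> real"
  assumes t: "t > 0" and V: "finite V" "V \<subseteq> \<int> \<times> \<int>"
    and B: "B \<in> sets borel" "B \<subseteq> {z. \<lfloor>fst z / t\<rfloor> = m \<and> \<lfloor>snd z / t\<rfloor> = n}"
    and f: "linear f" "f \<in> borel_measurable borel" "inj_on f V" and E: "E \<in> sets borel"
  shows "emeasure lborel (translates t V B \<inter> f -` E) =
    (\<Sum>c\<in>f ` V. emeasure lborel {z \<in> B. t * c + f z \<in> E})"
proof -
  have fE: "f -` E \<in> sets borel" using measurable_sets[OF f(2) E] by simp
  define T where "T v = {z. - (t *\<^sub>R v) + z \<in> B}" for v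
  have T: "T v \<in> sets borel" for v
    unfolding T_def by (rule emeasure_lborel_translate(1)[OF B(1)])
  have "translates t V B \<inter> f -` E = (\<Union>v\<in>V. T v \<inter> f -` E)"
    by (auto simp: translates_def T_def)
  also have "emeasure lborel \<dots> = (\<Sum>v\<in>V. emeasure lborel (T v \<inter> f -` E))"
  proof (rule sum_emeasure[symmetric])
    show "disjoint_family_on (\<lambda>v. T v \<inter> f -` E) V"
      using grid_translates_disjoint[OF t _ _ _ _ B(2)] V(2)
      unfolding disjoint_family_on_def T_def by blast
  qed (use T fE V in auto)
  also have "\<dots> = (\<Sum>v\<in>V. emeasure lborel {z \<in> B. t * f v + f z \<in> E})"
  proof (rule sum.cong[OF refl])
    fix v
    \<comment> \<open>Translation by \<open>t v\<close> carries the piece \<open>T v\<close> back to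
      \<open>B\<close>, and linearity of \<open>f\<close> turns it into the shift
      \<open>t * f v\<close> of the values.\<close>
    have "emeasure lborel (T v \<inter> f -` E) = emeasure lborel {z. t *\<^sub>R v + z \<in> T v \<inter> f -` E}"
      using T fE by (intro emeasure_lborel_translate(2)[symmetric]) auto
    also have "{z. t *\<^sub>R v + z \<in> T v \<inter> f -` E} = {z \<in> B. t * f v + f z \<in> E}"
      by (auto simp: T_def linear_add[OF f(1)] linear_scale[OF f(1)])
    finally show "emeasure lborel (T v \<inter> f -` E) = emeasure lborel {z \<in> B. t * f v + f z \<in> E}" .
  qed
  also have "\<dots> = (\<Sum>c\<in>f ` V. emeasure lborel {z \<in> B. t * c + f z \<in> E})"
    by (simp add: sum.reindex[OF f(3)])
  finally show ?thesis .
qed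

section \<open>The hexagon and its two alternating triples of vertices\<close>

text \<open>Every second vertex of the hexagon; the others form \<open>hexagon_neg\<close>. On
  either triple each of x, y and x + y takes the values -1, 0, 1 exactly once.\<close>

definition hexagon_pos :: "(real \<times> real) set" where
  "hexagon_pos = {(1, 0), (-1, 1), (0, -1)}"

definition hexagon_neg :: "(real \<times> real) set" where
  "hexagon_neg = {(0, 1), (-1, 0), (1, -1)}"

lemma hexagon_simps:
  "finite hexagon_pos" "finite hexagon_neg"
  "hexagon_pos \<subseteq> \<int> \<times> \<int>" "hexagon_neg \<subseteq> \<int> \<times> \<int>" "hexagon_pos \<inter> hexagon_neg = {}"
  by (auto simp: hexagon_pos_def hexagon_neg_def)

text \<open>\<open>P\<close> and \<open>N\<close> are the translates of one set \<open>B\<close>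
  along the two triples. The three maps are injective on each triple with a common image, so
  \<open>emeasure_translates_vimage\<close> yields the same sum for both.\<close>

lemma exists_hexagonal_sets:
  fixes A :: "(real \<times> real) set"
  assumes A: "A \<in> sets borel" "bounded A" "emeasure lborel A > 0"
  obtains P N where "P \<in> sets borel" "N \<in> sets borel" "P \<subseteq> A" "N \<subseteq> A" "P \<inter> N = {}"
    "emeasure lborel P > 0"
    "\<forall>f\<in>{\<lambda>(x, y). x, \<lambda>(x, y). y, \<lambda>(x, y). x + y}. \<forall>E\<in>sets borel.
      emeasure lborel (P \<inter> f -` E) = emeasure lborel (N \<inter> f -` E)"
proof -
  define V where "V = hexagon_pos \<union> hexagon_neg"
  have V: "finite V" "V \<subseteq> \<int> \<times> \<int>" using hexagon_simps by (auto simp: V_def)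
  obtain t :: real where t: "t > 0" "emeasure lborel (\<Inter>v\<in>V. {z. t *\<^sub>R v + z \<in> A}) > 0"
    using common_translates_pos[OF A V(1)] .
  define G where "G = (\<Inter>v\<in>V. {z. t *\<^sub>R v + z \<in> A})"
  have "G \<in> sets borel"
    unfolding G_def using V(1)
    by (intro sets.finite_INT emeasure_lborel_translate(1) A(1)) (simp_all add: V_def hexagon_pos_def)
  moreover have "emeasure lborel G > 0" using t(2) by (simp only: G_def)
  ultimately obtain m n where B: "{z \<in> G. \<lfloor>fst z / t\<rfloor> = m \<and> \<lfloor>snd z / t\<rfloor> = n} \<in> sets borel"
    "emeasure lborel {z \<in> G. \<lfloor>fst z / t\<rfloor> = m \<and> \<lfloor>snd z / t\<rfloor> = n} > 0"
    by (rule exists_grid_cell_pos)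
  \<comment> \<open>Lying in \<open>G\<close> puts all six translates of \<open>B\<close> inside
    \<open>A\<close>; lying in one cell makes them disjoint.\<close>
  define B where "B = {z \<in> G. \<lfloor>fst z / t\<rfloor> = m \<and> \<lfloor>snd z / t\<rfloor> = n}"
  have BG: "B \<subseteq> G" and cell: "B \<subseteq> {z. \<lfloor>fst z / t\<rfloor> = m \<and> \<lfloor>snd z / t\<rfloor> = n}"
    and Bb: "B \<in> sets borel" using B(1) by (auto simp: B_def)
  define P where "P = translates t hexagon_pos B"
  define N where "N = translates t hexagon_neg B"
  have sub: "translates t W B \<subseteq> A" if "W \<subseteq> V" for W
  proof
    fix z assume "z \<in> translates t W B"
    then obtain v where v: "v \<in> W" "- (t *\<^sub>R v) + z \<in> B" by (auto simp: translates_def)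
    then have "t *\<^sub>R v + (- (t *\<^sub>R v) + z) \<in> A" using BG that unfolding G_def by blast
    then show "z \<in> A" by simp
  qed
  show thesis
  proof
    show Pb: "P \<in> sets borel" and "N \<in> sets borel"
      unfolding P_def N_def using hexagon_simps Bb by (auto intro: translates_borel)
    show "P \<subseteq> A" "N \<subseteq> A" unfolding P_def N_def by (auto intro!: sub simp: V_def)
    show "P \<inter> N = {}"
      using grid_translates_disjoint[OF t(1) _ _ _ _ cell] hexagon_simps(3-5)
      unfolding P_def N_def translates_def by blast
    \<comment> \<open>A single translate, the one at the vertex \<open>(1, 0)\<close>, already gives
      \<open>P\<close> positive measure.\<close>
    have "emeasure lborel B = emeasure lborel {z. - (t *\<^sub>R (1, 0)) + z \<in> B}"
      using emeasure_lborel_translate(2)[OF Bb] by simp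
    also have "\<dots> \<le> emeasure lborel P"
      using Pb by (intro emeasure_mono) (auto simp: P_def translates_def hexagon_pos_def)
    finally show "emeasure lborel P > 0" using B(2) by (simp add: B_def)
    have "emeasure lborel (P \<inter> f -` E) = emeasure lborel (N \<inter> f -` E)"
      if f: "f \<in> {\<lambda>(x, y). x, \<lambda>(x, y). y, \<lambda>(x, y). x + y}" and E: "E \<in> sets borel"
      for f :: "real \<times> real \<Rightarrow> real" and E :: "real set"
    proof -
      have "linear f" using f by (auto intro!: linearI simp: algebra_simps)
      moreover have "f \<in> borel_measurable borel" using f borel_Pr_maps by blast
      moreover have "inj_on f hexagon_pos" "inj_on f hexagon_neg"
        using f by (auto simp: hexagon_pos_def hexagon_neg_def)
      moreover have "f ` hexagon_pos = f ` hexagon_neg"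
        using f by (auto simp: hexagon_pos_def hexagon_neg_def)
      ultimately show ?thesis
        unfolding P_def N_def using hexagon_simps Bb E t(1)
        by (simp add: emeasure_translates_vimage[OF _ _ _ _ cell])
    qed
    then show "\<forall>f\<in>{\<lambda>(x, y). x, \<lambda>(x, y). y, \<lambda>(x, y). x + y}. \<forall>E\<in>sets borel.
      emeasure lborel (P \<inter> f -` E) = emeasure lborel (N \<inter> f -` E)" by blast
  qed
qed

section \<open>Moving mass along the hexagon against extremality\<close>

theorem theorem7p1:
  fixes \<mu>x \<mu>y \<mu>s :: "real measure" and \<pi> :: "(real \<times> real) measure"
  assumes "borel_prob \<mu>x" and "compactly_supported \<mu>x"
    and "borel_prob \<mu>y" and "compactly_supported \<mu>y"
    and "borel_prob \<mu>s" and "compactly_supported \<mu>s"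
    and "plans \<mu>x \<mu>y \<mu>s \<noteq> {}"
    and "extreme_measure (plans \<mu>x \<mu>y \<mu>s) \<pi>"
  shows "\<exists>S. S \<in> null_sets (lborel :: (real \<times> real) measure) \<and> emeasure \<pi> S = 1"
proof (rule ccontr)
  assume contra: "\<not> ?thesis"
  from assms(8) have "prob_space \<pi>" and s: "sets \<pi> = sets borel"
    by (auto simp: extreme_measure_def plans_def borel_prob_def)
  interpret \<pi>: prob_space \<pi> by fact
  have "emeasure \<pi> UNIV = 1"
    using \<pi>.emeasure_space_1 sets_eq_imp_space_eq[OF s] by simp
  \<comment> \<open>The null-set alternative would provide the set \<open>S\<close> excluded by
    \<open>contra\<close>, so the domination alternative holds.\<close>
  then obtain A \<epsilon> where A: "A \<in> sets borel" "bounded A" "emeasure lborel A > 0" and \<epsilon>: "\<epsilon> > 0"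
    and dom: "\<And>X. X \<in> sets borel \<Longrightarrow> X \<subseteq> A \<Longrightarrow> ennreal \<epsilon> * emeasure lborel X \<le> emeasure \<pi> X"
    using null_or_dominates_lborel[OF \<pi>.finite_measure_axioms s] contra by metis
  obtain P N where PN: "P \<in> sets borel" "N \<in> sets borel" "P \<subseteq> A" "N \<subseteq> A" "P \<inter> N = {}"
      "emeasure lborel P > 0"
    and hex: "\<forall>f\<in>{\<lambda>(x, y). x, \<lambda>(x, y). y, \<lambda>(x, y). x + y}. \<forall>E\<in>sets borel.
      emeasure lborel (P \<inter> f -` E) = emeasure lborel (N \<inter> f -` E)"
    using exists_hexagonal_sets[OF A] .
  \<comment> \<open>The mass to be moved: \<epsilon> times Lebesgue measure on \<open>C\<close>,
    which lies below \<pi> as soon as \<open>C\<close> is contained in \<open>A\<close>.\<close>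
  define R where "R C = scale_measure (ennreal \<epsilon>) (density lborel (indicator C :: _ \<Rightarrow> ennreal))"
    for C :: "(real \<times> real) set"
  have R_sets: "sets (R C) = sets borel" for C by (simp add: R_def)
  have R_space: "space (R C) = UNIV" for C using sets_eq_imp_space_eq[OF R_sets] by simp
  have R: "emeasure (R C) X = ennreal \<epsilon> * emeasure lborel (C \<inter> X)"
    if "C \<in> sets borel" "X \<in> sets borel" for C X
    using that by (simp add: R_def emeasure_restricted)
  have R_le: "emeasure (R C) X \<le> emeasure \<pi> X"
    if "C \<in> sets borel" "C \<subseteq> A" "X \<in> sets borel" for C X
  proof -
    have "emeasure (R C) X \<le> emeasure \<pi> (C \<inter> X)"
      using that by (subst R) (auto intro!: dom)
    also have "\<dots> \<le> emeasure \<pi> X" using that s by (intro emeasure_mono) auto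
    finally show ?thesis .
  qed
  have R_fin: "finite_measure (R C)" if "C \<in> sets borel" "C \<subseteq> A" for C
  proof (rule finite_measureI)
    have "emeasure (R C) UNIV \<le> emeasure \<pi> UNIV" using R_le that by simp
    then show "emeasure (R C) (space (R C)) \<noteq> \<infinity>"
      using \<open>emeasure \<pi> UNIV = 1\<close> by (auto simp: R_space top_unique)
  qed
  have distr_eq: "distr (R N) borel f = distr (R P) borel f"
    if f: "f \<in> {\<lambda>(x, y). x, \<lambda>(x, y). y, \<lambda>(x, y). x + y}" for f
  proof (rule measure_eqI)
    fix E assume "E \<in> sets (distr (R N) borel f)"
    then have E: "E \<in> sets borel" by simp
    have fm: "f \<in> borel_measurable borel" using f borel_Pr_maps by blast
    then have "f \<in> borel_measurable (R C)" for C
      by (simp add: R_sets cong: measurable_cong_sets)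
    moreover have "f -` E \<in> sets borel" using measurable_sets[OF fm E] by simp
    ultimately show "emeasure (distr (R N) borel f) E = emeasure (distr (R P) borel f) E"
      using E bspec[OF bspec[OF hex f] E] PN by (simp add: emeasure_distr R R_space)
  qed simp
  have Pr: "Pr_x (R N) = Pr_x (R P)" "Pr_y (R N) = Pr_y (R P)" "Pr_sum (R N) = Pr_sum (R P)"
    unfolding Pr_x_def Pr_y_def Pr_sum_def by (auto intro!: distr_eq)
  \<comment> \<open>Rigidity is tested on \<open>P\<close> itself, which \<open>R N\<close> does not
    charge by disjointness while \<open>R P\<close> gives it positive mass.\<close>
  have "measure (R N) P = measure (R P) P"
    by (rule extreme_plan_rigid[OF assms(8) R_fin R_fin R_sets R_sets R_le R_le Pr])
      (use PN in auto)
  moreover have "measure (R N) P = 0"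
    using PN R[of N P] by (simp add: measure_def Int_commute)
  moreover have "measure (R P) P > 0"
  proof -
    interpret RP: finite_measure "R P" using R_fin PN by simp
    have "emeasure (R P) P > 0" using R[of P P] PN \<epsilon> by (simp add: ennreal_zero_less_mult_iff)
    then show ?thesis by (simp add: RP.emeasure_eq_measure)
  qed
  ultimately show False by simp
qed

end
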